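(* Every MT-algebra $M$ admits a compactification; that is, there exist a compact MT-algebra $N$ and a dense MT-embedding $h:N\to M$.
   Context: An MT-algebra is a pair $(M,\square)$, where $M$ is a complete Boolean algebra and $\square:M\to M$ satisfies $\square 1=1$, $\square(a\wedge b)=\square a\wedge\square b$, $\square a\le a$, $\square a\le\square\square a$. An element $a$ is open if $a=\square a$; $\mathcal O(M)$ is the set (a frame) of open elements. An MT-morphism $h:N\to M$ is a complete Boolean homomorphism with $h(\square a)\le\square h(a)$ for all $a$; it restricts to a frame homomorphism $\mathcal O(h):\mathcal O(N)\to\mathcal O(M)$. $M$ is compact if whenever $\bigvee S=1$ with $S\subseteq\mathcal O(M)$, there is a finite $T\subseteq S$ with $\bigvee T=1$. An MT-morphism $h:N\to M$ is dense if $h(u)=0$ implies $u=0$ for every $u\in\mathcal O(N)$, and is an MT-embedding if both $h$ and $\mathcal O(h)$ are onto. A compactification of $M$ is a pair $(N,h)$ with $N$ a compact MT-algebra and $h:N\to M$ a dense MT-embedding. *)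

theory Defs
  imports "HOL-Algebra.Complete_Lattice"
begin

text \<open>
  The type class \<open>complete_boolean_algebra\<close> of HOL requires complete distributivity (and so
  only covers atomic algebras). We therefore work with carrier-based complete lattices that are
  distributive and complemented. The degenerate algebra with \<open>\<bottom> = \<top>\<close> is allowed.
\<close>

locale complete_boolean_alg = complete_lattice M for M (structure) +
  assumes meet_join_distrib:
      "\<lbrakk>x \<in> carrier M; y \<in> carrier M; z \<in> carrier M\<rbrakk>
       \<Longrightarrow> x \<sqinter> (y \<squnion> z) = (x \<sqinter> y) \<squnion> (x \<sqinter> z)"
    and complemented:
      "x \<in> carrier M \<Longrightarrow> \<exists>y\<in>carrier M. x \<sqinter> y = \<bottom> \<and> x \<squnion> y = \<top>"

definition complement :: "('a, 'm) gorder_scheme \<Rightarrow> 'a \<Rightarrow> 'a" where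
  "complement M x =
     (THE y. y \<in> carrier M \<and> x \<sqinter>\<^bsub>M\<^esub> y = \<bottom>\<^bsub>M\<^esub> \<and> x \<squnion>\<^bsub>M\<^esub> y = \<top>\<^bsub>M\<^esub>)"

record 'a mt_struct = "'a gorder" +
  box :: "'a \<Rightarrow> 'a"

locale mt_algebra = complete_boolean_alg M for M (structure) +
  assumes box_closed: "a \<in> carrier M \<Longrightarrow> box M a \<in> carrier M"
    and box_top: "box M \<top> = \<top>"
    and box_meet:
      "\<lbrakk>a \<in> carrier M; b \<in> carrier M\<rbrakk> \<Longrightarrow> box M (a \<sqinter> b) = box M a \<sqinter> box M b"
    and box_le: "a \<in> carrier M \<Longrightarrow> box M a \<sqsubseteq> a"
    and box_le_box_box: "a \<in> carrier M \<Longrightarrow> box M a \<sqsubseteq> box M (box M a)"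

definition opens :: "('a, 'm) mt_struct_scheme \<Rightarrow> 'a set" where
  "opens M = {a \<in> carrier M. a = box M a}"

definition mt_compact :: "('a, 'm) mt_struct_scheme \<Rightarrow> bool" where
  "mt_compact M \<longleftrightarrow>
     (\<forall>S \<subseteq> opens M. \<Squnion>\<^bsub>M\<^esub>S = \<top>\<^bsub>M\<^esub> \<longrightarrow>
        (\<exists>T \<subseteq> S. finite T \<and> \<Squnion>\<^bsub>M\<^esub>T = \<top>\<^bsub>M\<^esub>))"

text \<open>The case \<open>S = {}\<close> below says that \<open>\<bottom>\<close> and \<open>\<top>\<close> are preserved.\<close>

definition complete_boolean_hom ::
  "('b, 'n) gorder_scheme \<Rightarrow> ('a, 'm) gorder_scheme \<Rightarrow> ('b \<Rightarrow> 'a) \<Rightarrow> bool" where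
  "complete_boolean_hom N M h \<longleftrightarrow>
     h \<in> carrier N \<rightarrow> carrier M \<and>
     (\<forall>S \<subseteq> carrier N. h (\<Squnion>\<^bsub>N\<^esub>S) = \<Squnion>\<^bsub>M\<^esub>(h ` S)) \<and>
     (\<forall>S \<subseteq> carrier N. h (\<Sqinter>\<^bsub>N\<^esub>S) = \<Sqinter>\<^bsub>M\<^esub>(h ` S)) \<and>
     (\<forall>x \<in> carrier N. h (complement N x) = complement M (h x))"

definition mt_morphism ::
  "('b, 'n) mt_struct_scheme \<Rightarrow> ('a, 'm) mt_struct_scheme \<Rightarrow> ('b \<Rightarrow> 'a) \<Rightarrow> bool" where
  "mt_morphism N M h \<longleftrightarrow>
     complete_boolean_hom N M h \<and>
     (\<forall>a \<in> carrier N. h (box N a) \<sqsubseteq>\<^bsub>M\<^esub> box M (h a))"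

definition mt_dense ::
  "('b, 'n) mt_struct_scheme \<Rightarrow> ('a, 'm) mt_struct_scheme \<Rightarrow> ('b \<Rightarrow> 'a) \<Rightarrow> bool" where
  "mt_dense N M h \<longleftrightarrow> (\<forall>u \<in> opens N. h u = \<bottom>\<^bsub>M\<^esub> \<longrightarrow> u = \<bottom>\<^bsub>N\<^esub>)"

definition mt_embedding ::
  "('b, 'n) mt_struct_scheme \<Rightarrow> ('a, 'm) mt_struct_scheme \<Rightarrow> ('b \<Rightarrow> 'a) \<Rightarrow> bool" where
  "mt_embedding N M h \<longleftrightarrow>
     mt_morphism N M h \<and> h ` carrier N = carrier M \<and> h ` opens N = opens M"

definition compactification ::
  "('a, 'm) mt_struct_scheme \<Rightarrow> ('b, 'n) mt_struct_scheme \<Rightarrow> ('b \<Rightarrow> 'a) \<Rightarrow> bool" where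
  "compactification M N h \<longleftrightarrow>
     mt_algebra N \<and> mt_compact N \<and> mt_embedding N M h \<and> mt_dense N M h"

end

theory Submission
  imports Defs
begin

text \<open>
  The classical extension \<open>X \<union> {\<infinity>}\<close> in which the only open set containing \<open>\<infinity>\<close> is the whole space
  is compact and contains \<open>X\<close> as a dense open subspace. Its MT-algebra is \<open>M \<times> 2\<close>, the second
  coordinate recording membership of \<open>\<infinity>\<close>, and the embedding is the first projection. For the
  trivial algebra the added point would not be in the closure of \<open>X\<close>, so nothing is added then.
\<close>

definition one_point_ext :: "('a, 'm) mt_struct_scheme \<Rightarrow> ('a \<times> bool) mt_struct" where
  "one_point_ext M =
     \<lparr>carrier = carrier M \<times> {b. b \<longrightarrow> \<bottom>\<^bsub>M\<^esub> \<noteq> \<top>\<^bsub>M\<^esub>},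
      eq = (=),
      le = (\<lambda>x y. fst x \<sqsubseteq>\<^bsub>M\<^esub> fst y \<and> (snd x \<longrightarrow> snd y)),
      box = (\<lambda>x. if x = (\<top>\<^bsub>M\<^esub>, \<bottom>\<^bsub>M\<^esub> \<noteq> \<top>\<^bsub>M\<^esub>) then x else (box M (fst x), False))\<rparr>"

section \<open>Complements and bounds in a general lattice\<close>

lemma (in complete_boolean_alg) complement_unique:
  assumes "x \<in> carrier M" "y \<in> carrier M" "z \<in> carrier M"
    and "x \<sqinter> y = \<bottom>" "x \<squnion> y = \<top>" "x \<sqinter> z = \<bottom>" "x \<squnion> z = \<top>"
  shows "y = z"
proof -
  \<comment> \<open>Meeting \<open>u\<close> with \<top> = \<open>x\<close> \<squnion>
    \<open>v\<close> and distributing kills \<open>u\<close> \<sqinter> \<open>x\<close>. Applied to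
    (\<open>y\<close>, \<open>z\<close>) and to (\<open>z\<close>, \<open>y\<close>), this gives
    both halves of antisymmetry.\<close>
  have le: "u \<sqsubseteq> v" if "u \<in> carrier M" "v \<in> carrier M" "x \<sqinter> u = \<bottom>" "x \<squnion> v = \<top>" for u v
  proof -
    have "u = \<top> \<sqinter> u"
      using top_meet[OF that(1)] by (simp add: eq_is_equal)
    also have "\<dots> = u \<sqinter> (x \<squnion> v)"
      unfolding that(4) by (rule meet_comm)
    also have "\<dots> = (u \<sqinter> x) \<squnion> (u \<sqinter> v)"
      by (rule meet_join_distrib[OF that(1) assms(1) that(2)])
    also have "\<dots> = \<bottom> \<squnion> (u \<sqinter> v)"
      using that(3) by (simp add: meet_comm)
    also have "\<dots> = u \<sqinter> v"
      using bottom_join[of "u \<sqinter> v"] that by (simp add: eq_is_equal)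
    finally show ?thesis
      using meet_right[OF that(1,2)] by simp
  qed
  show ?thesis
    using assms le by (intro le_antisym) auto
qed

lemma (in complete_boolean_alg) complement_eqI:
  assumes "x \<in> carrier M" "y \<in> carrier M" "x \<sqinter> y = \<bottom>" "x \<squnion> y = \<top>"
  shows "complement M x = y"
  unfolding complement_def
  by (rule the_equality) (use assms in \<open>auto intro: complement_unique\<close>)

context complete_lattice
begin

text \<open>A join is by definition some chosen least upper bound; uniqueness of least elements
  makes it computable from an explicit candidate.\<close>

lemma sup_eqI: "\<Squnion>A = s" if "least L s (Upper L A)"
  unfolding sup_def using that by (blast intro: least_unique)

lemma inf_eqI: "\<Sqinter>A = i" if "greatest L i (Lower L A)"
  unfolding inf_def using that by (blast intro: greatest_unique)

lemma top_eq_inf: "\<top> = \<Sqinter>{}"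
  by (simp add: inf_def top_def)

lemma bottom_eq_sup: "\<bottom> = \<Squnion>{}"
  by (simp add: sup_def bottom_def)

end

context mt_algebra
begin

section \<open>The extension as a complete Boolean algebra\<close>

abbreviation (input) N where "N \<equiv> one_point_ext M"

lemma carrier_ext: "x \<in> carrier N \<longleftrightarrow> fst x \<in> carrier M \<and> (snd x \<longrightarrow> \<bottom> \<noteq> \<top>)"
  by (cases x) (auto simp: one_point_ext_def)

lemma le_ext: "x \<sqsubseteq>\<^bsub>N\<^esub> y \<longleftrightarrow> fst x \<sqsubseteq> fst y \<and> (snd x \<longrightarrow> snd y)"
  by (simp add: one_point_ext_def)

lemma partial_order_ext: "partial_order N"
  by unfold_locales (auto simp: one_point_ext_def intro: le_trans)

lemma least_ext:
  assumes "S \<subseteq> carrier N"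
  shows "least N (\<Squnion>(fst ` S), True \<in> snd ` S) (Upper N S)"
proof -
  interpret N: partial_order N by (rule partial_order_ext)
  have sub: "fst ` S \<subseteq> carrier M"
    using assms by (auto simp: one_point_ext_def)
  show ?thesis
  proof (rule least_UpperI)
    show "x \<sqsubseteq>\<^bsub>N\<^esub> (\<Squnion>(fst ` S), True \<in> snd ` S)" if "x \<in> S" for x
      using that sub by (auto simp: one_point_ext_def image_iff intro!: sup_upper)
    show "(\<Squnion>(fst ` S), True \<in> snd ` S) \<sqsubseteq>\<^bsub>N\<^esub> y" if "y \<in> Upper N S" for y
    proof -
      have y: "fst y \<in> carrier M"
        using that by (auto simp: one_point_ext_def Upper_def)
      have le: "fst x \<sqsubseteq> fst y \<and> (snd x \<longrightarrow> snd y)" if "x \<in> S" for x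
        using Upper_memD[OF \<open>y \<in> Upper N S\<close> that assms] by (simp add: le_ext)
      with y have "\<Squnion>(fst ` S) \<sqsubseteq> fst y"
        using sub by (intro sup_least) auto
      with le show ?thesis
        by (auto simp: one_point_ext_def)
    qed
    show "(\<Squnion>(fst ` S), True \<in> snd ` S) \<in> carrier N"
      using assms sub by (auto simp: one_point_ext_def)
  qed (use assms in auto)
qed

text \<open>Bounds are coordinatewise. The conjunct \<bottom> \<noteq> \<top> matters for the empty
  family: there the other condition holds vacuously, yet over the trivial algebra the second
  coordinate must stay \<open>False\<close>.\<close>

lemma greatest_ext:
  assumes "S \<subseteq> carrier N"
  shows "greatest N (\<Sqinter>(fst ` S), \<bottom> \<noteq> \<top> \<and> False \<notin> snd ` S) (Lower N S)"
proof -
  interpret N: partial_order N by (rule partial_order_ext)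
  have sub: "fst ` S \<subseteq> carrier M"
    using assms by (auto simp: one_point_ext_def)
  show ?thesis
  proof (rule greatest_LowerI)
    show "(\<Sqinter>(fst ` S), \<bottom> \<noteq> \<top> \<and> False \<notin> snd ` S) \<sqsubseteq>\<^bsub>N\<^esub> x" if "x \<in> S" for x
      using that sub by (auto simp: one_point_ext_def image_iff intro!: inf_lower)
    show "y \<sqsubseteq>\<^bsub>N\<^esub> (\<Sqinter>(fst ` S), \<bottom> \<noteq> \<top> \<and> False \<notin> snd ` S)" if "y \<in> Lower N S" for y
    proof -
      have y: "fst y \<in> carrier M" "snd y \<longrightarrow> \<bottom> \<noteq> \<top>"
        using that by (auto simp: one_point_ext_def Lower_def)
      have le: "fst y \<sqsubseteq> fst x \<and> (snd y \<longrightarrow> snd x)" if "x \<in> S" for x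
        using Lower_memD[OF \<open>y \<in> Lower N S\<close> that assms] by (simp add: le_ext)
      with y have "fst y \<sqsubseteq> \<Sqinter>(fst ` S)"
        using sub by (intro inf_greatest) auto
      with y le show ?thesis
        by (auto simp: one_point_ext_def)
    qed
    show "(\<Sqinter>(fst ` S), \<bottom> \<noteq> \<top> \<and> False \<notin> snd ` S) \<in> carrier N"
      using sub by (auto simp: one_point_ext_def)
  qed (use assms in auto)
qed

lemma complete_lattice_ext: "complete_lattice N"
proof -
  interpret N: partial_order N by (rule partial_order_ext)
  show ?thesis
    by unfold_locales (use least_ext greatest_ext in blast)+
qed

lemma sup_ext:
  "S \<subseteq> carrier N \<Longrightarrow> \<Squnion>\<^bsub>N\<^esub>S = (\<Squnion>(fst ` S), True \<in> snd ` S)"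
  by (rule complete_lattice.sup_eqI[OF complete_lattice_ext least_ext])

lemma inf_ext:
  "S \<subseteq> carrier N \<Longrightarrow> \<Sqinter>\<^bsub>N\<^esub>S = (\<Sqinter>(fst ` S), \<bottom> \<noteq> \<top> \<and> False \<notin> snd ` S)"
  by (rule complete_lattice.inf_eqI[OF complete_lattice_ext greatest_ext])

lemma top_ext: "\<top>\<^bsub>N\<^esub> = (\<top>, \<bottom> \<noteq> \<top>)"
  using inf_ext[of "{}"] complete_lattice.top_eq_inf[OF complete_lattice_ext]
  by (simp add: top_eq_inf)

lemma bottom_ext: "\<bottom>\<^bsub>N\<^esub> = (\<bottom>, False)"
  using sup_ext[of "{}"] complete_lattice.bottom_eq_sup[OF complete_lattice_ext]
  by (simp add: bottom_eq_sup)

lemma join_ext: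
  "\<lbrakk>x \<in> carrier N; y \<in> carrier N\<rbrakk> \<Longrightarrow> x \<squnion>\<^bsub>N\<^esub> y = (fst x \<squnion> fst y, snd x \<or> snd y)"
  by (auto simp: join_def sup_ext)

lemma meet_ext:
  "\<lbrakk>x \<in> carrier N; y \<in> carrier N\<rbrakk> \<Longrightarrow> x \<sqinter>\<^bsub>N\<^esub> y = (fst x \<sqinter> fst y, snd x \<and> snd y)"
  \<comment> \<open>The conjunct \<bottom> \<noteq> \<top> is absorbed, since a carrier element with
    true second coordinate already implies it.\<close>
  by (auto simp: meet_def inf_ext) (auto simp: one_point_ext_def)

lemma complete_boolean_alg_ext: "complete_boolean_alg N"
proof -
  interpret N: complete_lattice N by (rule complete_lattice_ext)
  show ?thesis
  proof unfold_locales
    fix x y z assume "x \<in> carrier N" "y \<in> carrier N" "z \<in> carrier N"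
    moreover from this have "y \<squnion>\<^bsub>N\<^esub> z \<in> carrier N" "x \<sqinter>\<^bsub>N\<^esub> y \<in> carrier N" "x \<sqinter>\<^bsub>N\<^esub> z \<in> carrier N"
      by auto
    ultimately show "x \<sqinter>\<^bsub>N\<^esub> (y \<squnion>\<^bsub>N\<^esub> z) = (x \<sqinter>\<^bsub>N\<^esub> y) \<squnion>\<^bsub>N\<^esub> (x \<sqinter>\<^bsub>N\<^esub> z)"
      by (auto simp: join_ext meet_ext carrier_ext meet_join_distrib)
  next
    fix x assume x: "x \<in> carrier N"
    then obtain y where "y \<in> carrier M" "fst x \<sqinter> y = \<bottom>" "fst x \<squnion> y = \<top>"
      using complemented carrier_ext by blast
    with x show "\<exists>y\<in>carrier N. x \<sqinter>\<^bsub>N\<^esub> y = \<bottom>\<^bsub>N\<^esub> \<and> x \<squnion>\<^bsub>N\<^esub> y = \<top>\<^bsub>N\<^esub>"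
      \<comment> \<open>Complement in each factor; over the trivial algebra the second factor has
        \<open>False\<close> as its only element.\<close>
      by (intro bexI[of _ "(y, \<bottom> \<noteq> \<top> \<and> \<not> snd x)"])
        (auto simp: join_ext meet_ext carrier_ext top_ext bottom_ext)
  qed
qed

section \<open>The interior operator, open elements and compactness\<close>

lemma box_ext: "box N x = (if x = \<top>\<^bsub>N\<^esub> then x else (box M (fst x), False))"
  unfolding top_ext by (simp add: one_point_ext_def)

text \<open>Both cases of the new box agree in the first coordinate because \<open>box M\<close>
  fixes \<top>. So the first halves of the box axioms come from \<open>M\<close>, and the projection
  even commutes with box.\<close>

lemma fst_box_ext: "fst (box N x) = box M (fst x)"
  by (auto simp: box_ext top_ext box_top)

lemma mt_algebra_ext: "mt_algebra N"
proof -
  interpret N: complete_boolean_alg N by (rule complete_boolean_alg_ext)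
  have closed: "box N a \<in> carrier N" if "a \<in> carrier N" for a
    using that by (auto simp: box_ext carrier_ext box_closed)
  show ?thesis
  proof unfold_locales
    show "box N \<top>\<^bsub>N\<^esub> = \<top>\<^bsub>N\<^esub>"
      by (simp add: box_ext)
    show "box N a \<sqsubseteq>\<^bsub>N\<^esub> a" if "a \<in> carrier N" for a
      using that by (auto simp: box_ext le_ext carrier_ext box_le)
    show "box N a \<sqsubseteq>\<^bsub>N\<^esub> box N (box N a)" if "a \<in> carrier N" for a
      using that box_le_box_box[of "fst a"]
      by (simp add: le_ext fst_box_ext carrier_ext) (simp add: box_ext)
    show "box N (a \<sqinter>\<^bsub>N\<^esub> b) = box N a \<sqinter>\<^bsub>N\<^esub> box N b"
      if ab: "a \<in> carrier N" "b \<in> carrier N" for a b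
    proof (rule prod_eqI)
      show "fst (box N (a \<sqinter>\<^bsub>N\<^esub> b)) = fst (box N a \<sqinter>\<^bsub>N\<^esub> box N b)"
        using ab closed[OF ab(1)] closed[OF ab(2)]
        by (simp add: fst_box_ext meet_ext box_meet) (simp add: carrier_ext box_meet)
      \<comment> \<open>A box can contain the added point only when its argument is the top, so the
        second coordinates agree once this equivalence is known.\<close>
      have "a \<sqinter>\<^bsub>N\<^esub> b = \<top>\<^bsub>N\<^esub> \<longleftrightarrow> a = \<top>\<^bsub>N\<^esub> \<and> b = \<top>\<^bsub>N\<^esub>"
      proof
        assume top: "a \<sqinter>\<^bsub>N\<^esub> b = \<top>\<^bsub>N\<^esub>"
        show "a = \<top>\<^bsub>N\<^esub> \<and> b = \<top>\<^bsub>N\<^esub>"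
          using ab N.meet_left[OF ab] N.meet_right[OF ab] unfolding top
          by blast
      next
        assume "a = \<top>\<^bsub>N\<^esub> \<and> b = \<top>\<^bsub>N\<^esub>"
        then show "a \<sqinter>\<^bsub>N\<^esub> b = \<top>\<^bsub>N\<^esub>"
          by (simp add: meet_def)
      qed
      then show "snd (box N (a \<sqinter>\<^bsub>N\<^esub> b)) = snd (box N a \<sqinter>\<^bsub>N\<^esub> box N b)"
        using closed[OF ab(1)] closed[OF ab(2)] by (simp add: meet_ext) (auto simp: box_ext)
    qed
  qed (rule closed)
qed

text \<open>Over the trivial algebra the two alternatives coincide, as the top is then (\<top>,
  \<open>False\<close>).\<close>

lemma opens_ext: "x \<in> opens N \<longleftrightarrow> x = \<top>\<^bsub>N\<^esub> \<or> (fst x \<in> opens M \<and> \<not> snd x)"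
proof -
  interpret N: mt_algebra N by (rule mt_algebra_ext)
  show ?thesis
    by (cases "x = \<top>\<^bsub>N\<^esub>"; cases x) (auto simp: opens_def box_ext carrier_ext[of "(_, _)"])
qed

text \<open>Over a nontrivial \<open>M\<close>, some member of a cover must contain the added point,
  and the only such open element is the top, which covers alone.\<close>

lemma mt_compact_ext: "mt_compact N"
  unfolding mt_compact_def
proof (intro allI impI)
  interpret N: mt_algebra N by (rule mt_algebra_ext)
  fix S assume S: "S \<subseteq> opens N" and cover: "\<Squnion>\<^bsub>N\<^esub>S = \<top>\<^bsub>N\<^esub>"
  show "\<exists>T\<subseteq>S. finite T \<and> \<Squnion>\<^bsub>N\<^esub>T = \<top>\<^bsub>N\<^esub>"
  proof (cases "\<top>\<^bsub>N\<^esub> \<in> S")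
    case True
    then show ?thesis
      by (intro exI[of _ "{\<top>\<^bsub>N\<^esub>}"]) simp
  next
    case False
    have "S \<subseteq> carrier N"
      using S by (auto simp: opens_def)
    then have "snd \<top>\<^bsub>N\<^esub> \<longleftrightarrow> True \<in> snd ` S"
      using cover sup_ext by (metis snd_conv)
    moreover have "\<not> snd s" if "s \<in> S" for s
      using that S False opens_ext[of s] by blast
    ultimately have "\<bottom> = \<top>"
      by (auto simp: top_ext)
    \<comment> \<open>A cover omitting the top forces \<open>M\<close> to be trivial, and then the
      empty subfamily covers.\<close>
    then have "\<Squnion>\<^bsub>N\<^esub>{} = \<top>\<^bsub>N\<^esub>"
      by (simp add: N.bottom_eq_sup[symmetric] top_ext bottom_ext)
    then show ?thesis
      by blast
  qed
qed

section \<open>The projection as a dense embedding\<close>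

lemma complete_boolean_hom_ext: "complete_boolean_hom N M fst"
proof -
  interpret N: mt_algebra N by (rule mt_algebra_ext)
  have "fst (complement N x) = complement M (fst x)" if x: "x \<in> carrier N" for x
  proof -
    \<comment> \<open>One witness evaluates \<open>complement\<close> on both sides: its first
      coordinate satisfies the equations that determine the complement in \<open>M\<close>.\<close>
    obtain y where y: "y \<in> carrier N" "x \<sqinter>\<^bsub>N\<^esub> y = \<bottom>\<^bsub>N\<^esub>" "x \<squnion>\<^bsub>N\<^esub> y = \<top>\<^bsub>N\<^esub>"
      using N.complemented[OF x] by blast
    then have "complement M (fst x) = fst y"
      using x by (intro complement_eqI) (auto simp: carrier_ext meet_ext join_ext top_ext bottom_ext)
    with N.complement_eqI[OF x y] show ?thesis
      by simp
  qed
  then show ?thesis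
    by (auto simp: complete_boolean_hom_def sup_ext inf_ext carrier_ext)
qed

lemma mt_embedding_ext: "mt_embedding N M fst"
proof -
  have "fst ` carrier N = carrier M"
  proof
    show "carrier M \<subseteq> fst ` carrier N"
      by (rule subsetI, rule image_eqI[of _ _ "(_, False)"]) (auto simp: carrier_ext)
  qed (auto simp: carrier_ext)
  \<comment> \<open>The top of the extension projects to \<top>; every other open element projects
    into \<open>opens M\<close>, and \<open>a\<close> \<mapsto> (\<open>a\<close>,
    \<open>False\<close>) gives surjectivity.\<close>
  moreover have "\<top> \<in> opens M"
    by (simp add: opens_def box_top)
  then have "fst ` opens N = opens M"
    by (auto simp: opens_ext top_ext intro!: image_eqI[of _ _ "(_, False)"])
  ultimately show ?thesis
    using complete_boolean_hom_ext
    by (auto simp: mt_embedding_def mt_morphism_def fst_box_ext carrier_ext box_closed)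
qed

text \<open>If the open element is the top and projects to \<bottom>, then \<bottom> = \<top>, so no
  point was added and the top is the bottom. Any other open element has second coordinate
  \<open>False\<close>.\<close>

lemma mt_dense_ext: "mt_dense N M fst"
  by (auto simp: mt_dense_def opens_ext top_ext bottom_ext prod_eq_iff)

end

theorem corollary3p17:
  fixes M :: "'a mt_struct"
  assumes "mt_algebra M"
  shows "\<exists>(N :: ('a \<times> bool) mt_struct) (h :: 'a \<times> bool \<Rightarrow> 'a). compactification M N h"
proof -
  interpret mt_algebra M by (rule assms)
  show ?thesis
    unfolding compactification_def
    using mt_algebra_ext mt_compact_ext mt_embedding_ext mt_dense_ext by blast
qed

end
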